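(* Let $b\ge 2$ be an integer and let $W$ have the same distribution as $W_{TC}$, i.e. $\mathbb{P}(W=b)=b^{-1}$ and $\mathbb{P}(W=0)=1-b^{-1}$. Let $(Y_n)_{n\ge 1}$ be the Mandelbrot cascade martingale associated with $W$ and $b$. Then for any real $q>1$, $$\lim_{n\to\infty}\frac{\log \mathbb{E}[Y_n^q]}{\log n}=q-1.$$
   Context: For a non-negative random variable $W$ with $\mathbb{E}[W]=1$, let $W(j_1,\dots,j_m)$, for $m\ge 1$ and $j_1,\dots,j_m\in\{0,\dots,b-1\}$, be independent copies of $W$ indexed by all non-empty finite words over $\{0,\dots,b-1\}$. The Mandelbrot cascade martingale is $$Y_n = b^{-n}\sum_{j_1,\dots,j_n\in\{0,\dots,b-1\}} W(j_1)W(j_1,j_2)\cdots W(j_1,j_2,\dots,j_n),\qquad n\ge 1.$$ *)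

theory Defs
  imports "HOL-Probability.Probability"
begin

definition words :: "nat \<Rightarrow> nat \<Rightarrow> nat list set" where
  "words b n = {j. length j = n \<and> set j \<subseteq> {0..<b}}"

definition nonempty_words :: "nat \<Rightarrow> nat list set" where
  "nonempty_words b = (\<Union>m\<in>{1..}. words b m)"

definition independent_copies ::
  "'w measure \<Rightarrow> ('w \<Rightarrow> real) \<Rightarrow> 'a measure \<Rightarrow> 'i set \<Rightarrow> ('i \<Rightarrow> 'a \<Rightarrow> real) \<Rightarrow> bool" where
  "independent_copies N W M I X \<longleftrightarrow>
     prob_space.indep_vars M (\<lambda>_. borel) X I \<and>
     (\<forall>i\<in>I. distr M borel (X i) = distr N borel W)"

definition cascade :: "nat \<Rightarrow> (nat list \<Rightarrow> 'a \<Rightarrow> real) \<Rightarrow> nat \<Rightarrow> 'a \<Rightarrow> real" where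
  "cascade b X n \<omega> =
     1 / real b ^ n * (\<Sum>j\<in>words b n. \<Prod>k = 1..n. X (take k j) \<omega>)"

(* Two conditions suffice: the masses sum to 1, so W takes no other value almost surely.
   In particular W is almost surely non-negative and has mean 1. *)
definition has_TC_law :: "nat \<Rightarrow> 'w measure \<Rightarrow> ('w \<Rightarrow> real) \<Rightarrow> bool" where
  "has_TC_law b N W \<longleftrightarrow>
     W \<in> borel_measurable N \<and>
     measure N {\<omega> \<in> space N. W \<omega> = real b} = 1 / real b \<and>
     measure N {\<omega> \<in> space N. W \<omega> = 0} = 1 - 1 / real b"

end

theory Submission imports Defs begin

text \<open>
  Almost surely every \<open>X i\<close> is either \<open>0\<close> or \<open>b\<close>, so the product along a word \<open>j\<close> of length \<open>n\<close>
  is \<open>b ^ n\<close> if \<open>X\<close> equals \<open>b\<close> on all non-empty prefixes of \<open>j\<close> and \<open>0\<close> otherwise. The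
  normalisation \<open>b ^ (- n)\<close> cancels, and \<open>Y\<^sub>n\<close> is simply the number \<open>Z\<^sub>n\<close> of surviving words of
  length \<open>n\<close>: the size of generation \<open>n\<close> of a Galton-Watson process whose offspring law is binomial
  with parameters \<open>b\<close> and \<open>1 / b\<close>. Its mean is one, so the process is critical. It survives up to
  time \<open>n\<close> with probability of order \<open>1 / n\<close>, and then has size of order \<open>n\<close>; hence
  \<open>E[Z\<^sub>n powr q]\<close> is of order \<open>n powr (q - 1)\<close>.

  To make this precise, let \<open>g s = (1 - 1 / b + s / b) ^ b\<close> be the offspring generating function.
  Conditioning on the set of survivors at level \<open>n\<close> gives \<open>E[s ^ Z\<^sub>n] = (g ^^ n) s\<close> for every real
  \<open>s\<close> (\<open>expectation_power_survivors\<close>). On \<open>[0, 1]\<close> the function \<open>g\<close> is bounded below, and on \<open>[1, 2)\<close>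
  above, by a Moebius map with double fixed point \<open>1\<close>. Iterates of such maps are explicit: in the
  coordinate \<open>1 / (1 - s)\<close> they are translations. Two values of \<open>s\<close> are enough.

  For the lower bound take \<open>s = 0\<close>: the survival probability is at most \<open>b\<^sup>2 / n\<close>. As \<open>E[Z\<^sub>n] = 1\<close>
  is carried by so small an event, convexity of \<open>z powr q\<close> forces
  \<open>E[Z\<^sub>n powr q] \<ge> (n / b\<^sup>2) powr (q - 1)\<close> (\<open>moment_ge\<close>).

  For the upper bound take \<open>s = exp t\<close> with \<open>t = 1 / (4 n)\<close>, so close to \<open>1\<close> that \<open>n\<close> iterations
  at most double the distance to \<open>1\<close>: \<open>E[exp (t Z\<^sub>n)] - 1 \<le> 1 / n\<close>. Since \<open>z powr q\<close> is at most a
  constant times \<open>exp z - 1\<close>, the moment is at most a constant times \<open>t powr (- q) / n\<close>, which has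
  order \<open>n powr (q - 1)\<close> (\<open>moment_le\<close>). Dividing the logarithms of both bounds by \<open>ln n\<close> gives the limit.
\<close>

section \<open>The offspring generating function and its iterates\<close>

definition offspring_pgf :: "nat \<Rightarrow> real \<Rightarrow> real" where
  "offspring_pgf b s = (1 - 1 / real b + s / real b) ^ b"

lemma offspring_pgf_nonneg:
  assumes "b \<ge> 1" "s \<ge> 0"
  shows "offspring_pgf b s \<ge> 0"
  using assms by (auto simp: offspring_pgf_def)

lemma offspring_pgf_mono:
  assumes "b \<ge> 1" "0 \<le> s" "s \<le> t"
  shows "offspring_pgf b s \<le> offspring_pgf b t"
  unfolding offspring_pgf_def
proof (rule power_mono)
  show "1 - 1 / real b + s / real b \<le> 1 - 1 / real b + t / real b"
    using assms by (simp add: divide_right_mono)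
  show "0 \<le> 1 - 1 / real b + s / real b"
    using assms by simp
qed

text \<open>
  The comparison map \<open>1 + x \<mapsto> 1 / (1 - x)\<close> sends \<open>1 / x\<close> to \<open>1 / x - 1\<close>. The estimate is
  \<open>(1 + x / b) ^ b \<le> exp x\<close> followed by \<open>1 - x \<le> exp (- x)\<close>.
\<close>

lemma offspring_pgf_le_moebius:
  assumes "b \<ge> 1" "0 \<le> x" "x < 1"
  shows "offspring_pgf b (1 + x) \<le> 1 / (1 - x)"
proof -
  have "offspring_pgf b (1 + x) = (1 + x / real b) ^ b"
    by (simp add: offspring_pgf_def add_divide_distrib)
  also have "\<dots> \<le> exp x"
    using assms by (intro exp_ge_one_plus_x_over_n_power_n) auto
  also have "\<dots> = 1 / exp (- x)"
    by (simp add: exp_minus field_simps)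
  also have "\<dots> \<le> 1 / (1 - x)"
    using assms exp_ge_add_one_self[of "- x"] by (intro divide_left_mono) auto
  finally show ?thesis .
qed

text \<open>
  The bound is the \<open>m\<close>-th iterate of the comparison map above: its excess \<open>y\<close> over \<open>1\<close> satisfies
  \<open>1 / y = 1 / h - m\<close>. Nonnegativity rides along in the induction because \<open>offspring_pgf_mono\<close>
  asks for it.
\<close>

lemma offspring_pgf_iterate_le:
  assumes "b \<ge> 1" "h \<ge> 0" "real m * h < 1"
  shows "(offspring_pgf b ^^ m) (1 + h) \<le> 1 + h / (1 - real m * h)"
    and "0 \<le> (offspring_pgf b ^^ m) (1 + h)"
  using assms(3)
proof (induction m)
  case 0
  { case 1 show ?case by simp }
  { case 2 show ?case using assms by simp }
next
  case (Suc m)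
  have less: "real m * h < 1" and pos: "1 - real m * h - h > 0"
    if "real (Suc m) * h < 1"
    using that assms by (auto simp: algebra_simps)
  {
    case 1
    note less = less[OF 1] and pos = pos[OF 1]
    define x where "x = h / (1 - real m * h)"
    have x: "0 \<le> x" "x < 1"
      using less pos assms by (auto simp: x_def field_simps)
    have "(offspring_pgf b ^^ Suc m) (1 + h) \<le> offspring_pgf b (1 + x)"
      using Suc less assms unfolding x_def by (auto intro!: offspring_pgf_mono)
    also have "\<dots> \<le> 1 / (1 - x)"
      using x assms by (intro offspring_pgf_le_moebius)
    also have "1 - x = (1 - real m * h - h) / (1 - real m * h)"
      using less by (simp add: x_def field_simps)
    also have "1 / \<dots> = 1 + h / (1 - real (Suc m) * h)"
      using less pos by (simp add: field_simps)
    finally show ?case .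
  next
    case 2
    show ?case using Suc less[OF 2] assms by (auto intro!: offspring_pgf_nonneg)
  }
qed

text \<open>
  Strict convexity of \<open>g\<close> at \<open>1\<close> produces a quadratic gain: splitting off two factors of
  \<open>(1 - x / b) ^ b\<close> and treating the others by Bernoulli's inequality yields
  \<open>1 - x + x\<^sup>2 / b\<^sup>2\<close>. In Moebius form this says that \<open>1 / x\<close> grows by at least \<open>1 / b\<^sup>2\<close>.
\<close>

lemma offspring_pgf_ge_moebius:
  assumes b: "b \<ge> 2" and x: "0 \<le> x" "x \<le> 1"
  shows "1 - x / (1 + x / (real b)\<^sup>2) \<le> offspring_pgf b (1 - x)"
proof -
  define y where "y = x / real b"
  have y: "0 \<le> y" "y \<le> 1" and xy: "x = real b * y"
    using assms by (auto simp: y_def field_simps)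
  define d where "d = real (b - 2)"
  have d: "d \<ge> 0" "real b = d + 2"
    using b by (auto simp: d_def)
  have "1 - x / (1 + x / (real b)\<^sup>2) \<le> 1 - x + y\<^sup>2"
  proof -
    define c where "c = x / (real b)\<^sup>2"
    have c: "c \<ge> 0" "x * c = y\<^sup>2"
      using x by (auto simp: c_def y_def power2_eq_square)
    have "(x - x * c) * (1 + c) \<le> x"
      using x c by (simp add: algebra_simps)
    hence "x - x * c \<le> x / (1 + c)"
      using c by (simp add: pos_le_divide_eq)
    thus ?thesis using c by (simp add: c_def)
  qed
  also have "\<dots> \<le> (1 - y)\<^sup>2 * (1 - d * y)"
  proof -
    have "(1 - y)\<^sup>2 * (1 - d * y) - (1 - x + y\<^sup>2) = d * y\<^sup>2 * (2 - y)"
      unfolding xy d by (simp add: algebra_simps power2_eq_square)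
    also have "\<dots> \<ge> 0" using d y by simp
    finally show ?thesis by simp
  qed
  also have "\<dots> \<le> (1 - y)\<^sup>2 * (1 - y) ^ (b - 2)"
    using Bernoulli_inequality[of "- y" "b - 2"] y
    by (intro mult_left_mono) (auto simp: d_def)
  also have "\<dots> = (1 - y) ^ (2 + (b - 2))"
    by (rule power_add[symmetric])
  also have "2 + (b - 2) = b"
    using b by simp
  also have "(1 - y) ^ b = offspring_pgf b (1 - x)"
    by (simp add: offspring_pgf_def y_def diff_divide_distrib)
  finally show ?thesis .
qed

lemma offspring_pgf_iterate_ge:
  assumes b: "b \<ge> 2"
  shows "1 - (real b)\<^sup>2 / (real n + (real b)\<^sup>2) \<le> (offspring_pgf b ^^ n) 0"
proof (induction n)
  case 0
  show ?case using b by simp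
next
  case (Suc n)
  define B where "B = (real b)\<^sup>2"
  have B: "B > 0" using b by (simp add: B_def)
  define x where "x = B / (real n + B)"
  have x: "0 \<le> x" "x \<le> 1" using B by (auto simp: x_def field_simps)
  have "1 - B / (real (Suc n) + B) = 1 - x / (1 + x / B)"
  proof -
    have pos: "real n + B > 0" "real n + B + 1 > 0" using B by auto
    have "1 + x / B = (real n + B + 1) / (real n + B)"
      using B by (simp add: x_def add_divide_distrib)
    hence "x / (1 + x / B) = B / (real n + B + 1)"
      using pos by (simp add: x_def)
    thus ?thesis by (simp add: algebra_simps)
  qed
  also have "\<dots> \<le> offspring_pgf b (1 - x)"
    unfolding B_def using b x by (rule offspring_pgf_ge_moebius)
  also have "\<dots> \<le> offspring_pgf b ((offspring_pgf b ^^ n) 0)"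
    using Suc x b by (intro offspring_pgf_mono) (auto simp: x_def B_def)
  finally show ?case by (simp add: B_def)
qed

section \<open>Comparison of powers with exponentials and with linear functions\<close>

text \<open>
  With \<open>k = \<lceil>q\<rceil>\<close>: below \<open>1\<close> the power is at most \<open>x \<le> exp x - 1\<close>, above \<open>1\<close> it is at most
  \<open>x ^ k\<close>, which occurs in the exponential series with coefficient \<open>1 / k!\<close>. Subtracting \<open>1\<close> from
  the exponential matters: it is what makes the bound vanish on extinction.
\<close>

lemma powr_le_exp_minus_one:
  fixes x q :: real
  assumes "x \<ge> 0" "q \<ge> 1"
  shows "x powr q \<le> fact (nat \<lceil>q\<rceil>) * (exp x - 1)"
proof -
  define k where "k = nat \<lceil>q\<rceil>"
  have k: "q \<le> real k" "k \<ge> 1" using assms by (auto simp: k_def) linarith+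
  have ex: "x \<le> exp x - 1" using exp_ge_add_one_self[of x] by linarith
  show ?thesis
  proof (cases "x \<le> 1")
    case True
    have "x powr q \<le> x powr 1"
      using True assms by (intro powr_mono') auto
    also have "\<dots> \<le> 1 * (exp x - 1)" using assms ex by simp
    also have "\<dots> \<le> fact k * (exp x - 1)"
      using ex assms by (intro mult_right_mono) auto
    finally show ?thesis by (simp add: k_def)
  next
    case False
    have "x powr q \<le> x powr real k"
      using False k by (intro powr_mono) auto
    also have "\<dots> = x ^ k" using False by (simp add: powr_realpow)
    also have "\<dots> \<le> fact k * (exp x - 1)"
    proof -
      have s: "(\<lambda>n. x ^ n / fact n) sums exp x"
        using exp_converges[of x] by (simp add: field_simps scaleR_conv_of_real)
      have "(\<Sum>n\<in>{0, k}. x ^ n / fact n) \<le> exp x"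
        using assms sums_unique[OF s] sums_summable[OF s]
        by (metis (no_types, lifting) sum_le_suminf finite.emptyI finite.insertI
            divide_nonneg_pos fact_gt_zero zero_le_power)
      hence "1 + x ^ k / fact k \<le> exp x" using k by simp
      thus ?thesis by (simp add: field_simps)
    qed
    finally show ?thesis by (simp add: k_def)
  qed
qed

text \<open>
  For \<open>z \<noteq> 0\<close> the left-hand side is the tangent at \<open>l\<close> of the convex function \<open>z powr q\<close>. At \<open>z = 0\<close>
  the constant term of the tangent may be dropped, and this is where a small probability of being
  nonzero enters.
\<close>

lemma powr_ge_tangent:
  fixes z q l :: real
  assumes "z \<ge> 0" "q > 1" "l > 0"
  shows "l powr (q - 1) * (q * z - (q - 1) * l * of_bool (z \<noteq> 0)) \<le> z powr q"
proof (cases "z = 0")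
  case False
  define u where "u = z / l"
  have u: "u > 0" "z = l * u" using False assms by (auto simp: u_def)
  have "(u powr q) powr (1 / q) * 1 powr (1 - 1 / q) \<le> 1 / q * u powr q + (1 - 1 / q) * 1"
    using assms u by (intro Youngs_inequality_0) auto
  hence "u \<le> 1 / q * u powr q + (1 - 1 / q)"
    using u assms by (simp add: powr_powr)
  hence "q * u \<le> q * (1 / q * u powr q + (1 - 1 / q))"
    using assms by (intro mult_left_mono) auto
  also have "\<dots> = u powr q + (q - 1)"
    using assms by (simp add: distrib_left right_diff_distrib)
  finally have "q * u - (q - 1) \<le> u powr q"
    by simp
  hence "l powr q * (q * u - (q - 1)) \<le> l powr q * u powr q"
    by (intro mult_left_mono) auto
  also have "\<dots> = z powr q" using u assms by (simp add: powr_mult)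
  also have "l powr q * (q * u - (q - 1)) = l powr (q - 1) * l * (q * u - (q - 1))"
    using assms by (simp add: powr_mult_base powr_diff)
  finally show ?thesis using False by (simp add: u(2) algebra_simps)
qed auto

section \<open>The surviving words\<close>

text \<open>
  The environment is an argument \<open>x\<close> rather than a random family, so that the set of survivors can be
  seen as a measurable function on a finite product space and independence of levels applies to it.
\<close>

definition alive :: "nat \<Rightarrow> nat \<Rightarrow> (nat list \<Rightarrow> real) \<Rightarrow> nat list set" where
  "alive b n x = {j \<in> words b n. \<forall>k\<in>{1..n}. x (take k j) = real b}"

definition children :: "nat \<Rightarrow> nat list set \<Rightarrow> nat list set" where
  "children b S = (\<lambda>(j, i). j @ [i]) ` (S \<times> {0..<b})"

lemma finite_words [simp]: "finite (words b n)"
proof -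
  have "words b n = {xs. set xs \<subseteq> {0..<b} \<and> length xs = n}" by (auto simp: words_def)
  thus ?thesis using finite_lists_length_eq[of "{0..<b}" n] by simp
qed

lemma card_words: "card (words b n) = b ^ n"
proof -
  have "words b n = {xs. set xs \<subseteq> {0..<b} \<and> length xs = n}" by (auto simp: words_def)
  thus ?thesis using card_lists_length_eq[of "{0..<b}" n] by simp
qed

lemma alive_subset: "alive b n x \<subseteq> words b n"
  by (auto simp: alive_def)

lemma finite_alive [simp]: "finite (alive b n x)"
  by (rule finite_subset[OF alive_subset]) simp

lemma card_children: "card (children b S) = card S * b"
proof -
  have "inj_on (\<lambda>(j, i). j @ [i]) (S \<times> {0..<b})" by (auto simp: inj_on_def)
  thus ?thesis by (simp add: children_def card_image card_cartesian_product)
qed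

lemma children_subset:
  assumes "S \<subseteq> words b n"
  shows "children b S \<subseteq> words b (Suc n)"
  using assms by (fastforce simp: children_def words_def)

lemma take_in_words:
  assumes "j \<in> words b n" "k \<le> n"
  shows "take k j \<in> words b k"
  using assms by (auto simp: words_def dest: in_set_takeD)

lemma alive_Suc:
  "alive b (Suc n) x = {w \<in> children b (alive b n x). x w = real b}"
proof (intro equalityI subsetI)
  fix w assume w: "w \<in> alive b (Suc n) x"
  hence len: "length w = Suc n" and sw: "set w \<subseteq> {0..<b}"
    and al: "\<And>k. k \<in> {1..Suc n} \<Longrightarrow> x (take k w) = real b"
    by (auto simp: alive_def words_def)
  obtain j i where ji: "w = j @ [i]" using len by (metis append_butlast_last_id length_0_conv nat.distinct(1))
  have "x (take k j) = real b" if "k \<in> {1..n}" for k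
    using al[of k] that len by (auto simp: ji)
  hence "j \<in> alive b n x" using len sw by (auto simp: alive_def words_def ji)
  moreover have "i < b" using sw by (auto simp: ji)
  moreover have "x w = real b" using al[of "Suc n"] len by simp
  ultimately show "w \<in> {w \<in> children b (alive b n x). x w = real b}"
    by (auto simp: children_def ji)
next
  fix w assume "w \<in> {w \<in> children b (alive b n x). x w = real b}"
  then obtain j i where w: "w = j @ [i]" "i < b" "j \<in> alive b n x" "x w = real b"
    by (auto simp: children_def)
  have len: "length j = n" using w by (auto simp: alive_def words_def)
  have "x (take k w) = real b" if "k \<in> {1..Suc n}" for k
  proof (cases "k = Suc n")
    case True thus ?thesis using w len by simp
  next
    case False thus ?thesis using w that len by (auto simp: alive_def)
  qed
  thus "w \<in> alive b (Suc n) x" using w by (auto simp: alive_def words_def)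
qed

lemma cascade_eq_card_alive:
  assumes b: "b \<ge> 1" and X: "\<And>i. i \<in> nonempty_words b \<Longrightarrow> X i \<omega> \<in> {0, real b}"
  shows "cascade b X n \<omega> = real (card (alive b n (\<lambda>i. X i \<omega>)))"
proof -
  have "(\<Prod>k = 1..n. X (take k j) \<omega>) = real b ^ n * of_bool (j \<in> alive b n (\<lambda>i. X i \<omega>))"
    if j: "j \<in> words b n" for j
  proof (cases "j \<in> alive b n (\<lambda>i. X i \<omega>)")
    case True
    thus ?thesis by (simp add: alive_def)
  next
    case False
    then obtain k where k: "k \<in> {1..n}" "X (take k j) \<omega> \<noteq> real b"
      using j by (auto simp: alive_def)
    moreover have "take k j \<in> nonempty_words b"
      using take_in_words[OF j] k by (auto simp: nonempty_words_def)
    ultimately have "X (take k j) \<omega> = 0" using X by blast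
    thus ?thesis using k False by (auto intro!: prod_zero)
  qed
  hence "cascade b X n \<omega> = (\<Sum>j\<in>words b n. of_bool (j \<in> alive b n (\<lambda>i. X i \<omega>)))"
    using b by (simp add: cascade_def flip: sum_distrib_left)
  also have "\<dots> = real (card (alive b n (\<lambda>i. X i \<omega>)))"
    using alive_subset by (simp add: of_bool_def sum.If_cases Int_absorb1)
  finally show ?thesis .
qed

section \<open>Moments of the number of survivors\<close>

lemma sum_of_bool_eq_mult:
  fixes f :: "'i \<Rightarrow> real"
  assumes "finite A" "a \<in> A"
  shows "(\<Sum>x\<in>A. of_bool (a = x) * f x) = f a"
  using assms by (simp add: of_bool_def if_distrib[of "\<lambda>c. c * _"] cong: if_cong)

locale percolated_tree = prob_space M for M :: "'a measure" +
  fixes b :: nat and X :: "nat list \<Rightarrow> 'a \<Rightarrow> real"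
  assumes b: "b \<ge> 2"
    and indep: "indep_vars (\<lambda>_. borel) X (nonempty_words b)"
    and prob_open: "\<And>i. i \<in> nonempty_words b \<Longrightarrow> prob {\<omega> \<in> space M. X i \<omega> = real b} = 1 / real b"
begin

abbreviation survivors :: "nat \<Rightarrow> 'a \<Rightarrow> nat list set" where
  "survivors n \<omega> \<equiv> alive b n (\<lambda>i. X i \<omega>)"

abbreviation shallow_words :: "nat \<Rightarrow> nat list set" where
  "shallow_words n \<equiv> (\<Union>m\<in>{1..n}. words b m)"

lemma rv: "i \<in> nonempty_words b \<Longrightarrow> random_variable borel (X i)"
  using indep by (auto simp: indep_vars_def)

text \<open>
  Level \<open>n\<close> depends on finitely many coordinates only, those of the words of length between \<open>1\<close> and
  \<open>n\<close>, which are disjoint from the words of length \<open>n + 1\<close>.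
\<close>

lemma alive_measurable:
  "{x \<in> space (PiM (shallow_words n) (\<lambda>_. borel)). alive b n x = S}
     \<in> sets (PiM (shallow_words n) (\<lambda>_. borel :: real measure))"
proof -
  let ?P = "PiM (shallow_words n) (\<lambda>_. borel :: real measure)"
  have comp: "Measurable.pred ?P (\<lambda>x. x (take k j) = real b)" if "j \<in> words b n" "k \<in> {1..n}" for j k
  proof -
    have "take k j \<in> shallow_words n"
      using take_in_words[OF that(1), of k] that(2) by (intro UN_I[of k]) auto
    hence [measurable]: "(\<lambda>x. x (take k j)) \<in> borel_measurable ?P"
      by (rule measurable_component_singleton)
    show ?thesis by measurable
  qed
  have all: "Measurable.pred ?P (\<lambda>x. \<forall>k\<in>{1..n}. x (take k j) = real b)"
    if "j \<in> words b n" for j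
    by (rule pred_intros_finite(3)[OF finite_atLeastAtMost comp[OF that]])
  have mem: "Measurable.pred ?P (\<lambda>x. (j \<in> S) = (\<forall>k\<in>{1..n}. x (take k j) = real b))"
    if "j \<in> words b n" for j
  proof (cases "j \<in> S")
    case True
    thus ?thesis using all[OF that] by (simp only: True simp_thms)
  next
    case False
    thus ?thesis using pred_intros_logic(2)[OF all[OF that]] by (simp only: False simp_thms)
  qed
  have "Measurable.pred ?P (\<lambda>x. \<forall>j\<in>words b n. (j \<in> S) = (\<forall>k\<in>{1..n}. x (take k j) = real b))"
    by (rule pred_intros_finite(3)[OF finite_words mem])
  moreover have "(alive b n x = S) = (\<forall>j\<in>words b n. (j \<in> S) = (\<forall>k\<in>{1..n}. x (take k j) = real b))"
    if "S \<subseteq> words b n" for x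
    using that by (auto simp: alive_def)
  ultimately have pred: "Measurable.pred ?P (\<lambda>x. alive b n x = S)" if "S \<subseteq> words b n"
    using that by (simp only: simp_thms)
  show ?thesis
  proof (cases "S \<subseteq> words b n")
    case True
    show ?thesis by (rule predE[OF pred[OF True]])
  next
    case False
    hence "alive b n x \<noteq> S" for x using alive_subset by metis
    hence "{x \<in> space ?P. alive b n x = S} = {}" by blast
    thus ?thesis by (simp only: sets.empty_sets)
  qed
qed

lemma alive_restrict:
  assumes "shallow_words n \<subseteq> A"
  shows "alive b n (restrict x A) = alive b n x"
proof -
  have *: "restrict x A (take k j) = x (take k j)" if "j \<in> words b n" "k \<in> {1..n}" for j k
  proof -
    have "take k j \<in> words b k" using take_in_words[OF that(1), of k] that(2) by simp
    hence "take k j \<in> A" by (intro subsetD[OF assms] UN_I[OF that(2)])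
    thus ?thesis by simp
  qed
  show ?thesis
    unfolding alive_def by (intro Collect_cong conj_cong refl ball_cong) (simp only: *)
qed

lemma survivors_event: "{\<omega> \<in> space M. survivors n \<omega> = S} \<in> events"
proof -
  let ?Y = "\<lambda>\<omega>. \<lambda>i\<in>shallow_words n. X i \<omega>"
  let ?A = "{x \<in> space (PiM (shallow_words n) (\<lambda>_. borel)). alive b n x = S}"
  have Y: "?Y \<in> measurable M (PiM (shallow_words n) (\<lambda>_. borel))"
    by (intro measurable_restrict rv) (auto simp: nonempty_words_def)
  have "?Y \<omega> \<in> ?A \<longleftrightarrow> survivors n \<omega> = S" if "\<omega> \<in> space M" for \<omega>
    using measurable_space[OF Y that] alive_restrict[OF order_refl, of n "\<lambda>i. X i \<omega>"] by simp
  hence "{\<omega> \<in> space M. survivors n \<omega> = S} = ?Y -` ?A \<inter> space M"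
    by blast
  thus ?thesis
    using measurable_sets[OF Y alive_measurable] by simp
qed

text \<open>
  The set of survivors takes finitely many values; splitting over them replaces conditioning on
  level \<open>n\<close> below, and settles all questions of measurability and integrability.
\<close>

lemma survivors_function:
  fixes F :: "nat list set \<Rightarrow> real"
  shows "F (survivors n \<omega>) = (\<Sum>S\<in>Pow (words b n). of_bool (survivors n \<omega> = S) * F S)"
proof -
  have "finite (Pow (words b n))" "survivors n \<omega> \<in> Pow (words b n)"
    using alive_subset by simp_all
  thus ?thesis by (rule sum_of_bool_eq_mult[of _ "survivors n \<omega>" F, symmetric])
qed

lemma survivors_of_bool_measurable: "(\<lambda>\<omega>. of_bool (survivors n \<omega> = S) :: real) \<in> borel_measurable M"
proof -
  have *: "of_bool (survivors n \<omega> = S) = (indicator {\<omega> \<in> space M. survivors n \<omega> = S} \<omega> :: real)"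
    if "\<omega> \<in> space M" for \<omega>
    unfolding indicator_def mem_Collect_eq using that by (cases "survivors n \<omega> = S") (simp_all only: of_bool_eq simp_thms)
  show ?thesis
    by (rule measurable_cong[THEN iffD2, OF * borel_measurable_indicator[OF survivors_event]])
qed

lemma survivors_measurable: "(\<lambda>\<omega>. F (survivors n \<omega>) :: real) \<in> borel_measurable M"
proof -
  have "(\<lambda>\<omega>. \<Sum>S\<in>Pow (words b n). of_bool (survivors n \<omega> = S) * F S) \<in> borel_measurable M"
    by (rule borel_measurable_sum, rule borel_measurable_times)
       (rule survivors_of_bool_measurable, rule borel_measurable_const)
  thus ?thesis
    unfolding survivors_function[of F, symmetric] .
qed

lemma survivors_integrable: "integrable M (\<lambda>\<omega>. F (survivors n \<omega>) :: real)"
proof (rule integrable_const_bound[OF _ survivors_measurable])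
  have "norm (F (survivors n \<omega>)) \<le> Max ((\<lambda>S. norm (F S)) ` Pow (words b n))" for \<omega>
    by (rule Max_ge) (simp, rule imageI, rule PowI, rule alive_subset)
  thus "AE \<omega> in M. norm (F (survivors n \<omega>)) \<le> Max ((\<lambda>S. norm (F S)) ` Pow (words b n))"
    by (rule AE_I2)
qed

lemma expectation_survivors:
  fixes F :: "nat list set \<Rightarrow> real"
  shows "expectation (\<lambda>\<omega>. F (survivors n \<omega>))
      = (\<Sum>S\<in>Pow (words b n). expectation (\<lambda>\<omega>. of_bool (survivors n \<omega> = S)) * F S)"
proof -
  have int: "integrable M (\<lambda>\<omega>. of_bool (survivors n \<omega> = S) * c :: real)" for S c
    by (rule survivors_integrable[of "\<lambda>T. of_bool (T = S) * c"])
  show ?thesis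
    unfolding survivors_function[of F] Bochner_Integration.integral_sum[OF int] integral_mult_left_zero ..
qed

lemma expectation_power_open:
  fixes s :: real
  assumes "i \<in> nonempty_words b"
  shows "expectation (\<lambda>\<omega>. if X i \<omega> = real b then s else 1) = 1 - 1 / real b + s / real b"
proof -
  have [measurable]: "X i \<in> borel_measurable M" using assms by (rule rv)
  have int: "integrable M (indicator {\<omega> \<in> space M. X i \<omega> = real b} :: 'a \<Rightarrow> real)"
    by (rule integrable_const_bound[where B = 1]) auto
  have "(if X i \<omega> = real b then s else 1) = 1 + (s - 1) * indicator {\<omega> \<in> space M. X i \<omega> = real b} \<omega>"
    if "\<omega> \<in> space M" for \<omega>
    using that by auto
  hence "expectation (\<lambda>\<omega>. if X i \<omega> = real b then s else 1)
      = expectation (\<lambda>\<omega>. 1 + (s - 1) * indicator {\<omega> \<in> space M. X i \<omega> = real b} \<omega>)"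
    by (intro Bochner_Integration.integral_cong) auto
  also have "\<dots> = 1 + (s - 1) * prob {\<omega> \<in> space M. X i \<omega> = real b}"
    using int by (subst Bochner_Integration.integral_add) (auto simp: prob_space)
  finally show ?thesis using prob_open[OF assms] by (simp add: diff_divide_distrib)
qed

lemma expectation_power_children:
  fixes s :: real
  assumes "S \<subseteq> words b n"
  shows "expectation (\<lambda>\<omega>. \<Prod>w\<in>children b S. if X w \<omega> = real b then s else 1)
     = offspring_pgf b s ^ card S"
proof -
  have sub: "children b S \<subseteq> nonempty_words b"
    using children_subset[OF assms] by (auto simp: nonempty_words_def)
  have fin: "finite (children b S)"
    using children_subset[OF assms] finite_words finite_subset by blast
  have "expectation (\<lambda>\<omega>. \<Prod>w\<in>children b S. if X w \<omega> = real b then s else 1)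
      = (\<Prod>w\<in>children b S. expectation (\<lambda>\<omega>. if X w \<omega> = real b then s else 1))"
  proof (rule indep_vars_lebesgue_integral)
    show "indep_vars (\<lambda>_. borel) (\<lambda>w \<omega>. if X w \<omega> = real b then s else 1) (children b S)"
      by (rule indep_vars_compose2[OF indep_vars_subset[OF indep sub]]) measurable
    fix w assume "w \<in> children b S"
    hence [measurable]: "X w \<in> borel_measurable M" using sub by (intro rv) auto
    show "integrable M (\<lambda>\<omega>. if X w \<omega> = real b then s else 1)"
      by (rule integrable_const_bound[where B = "max \<bar>s\<bar> 1"]) auto
  qed (fact fin)
  also have "\<dots> = (1 - 1 / real b + s / real b) ^ card (children b S)"
    using sub by (subst prod.cong[OF refl expectation_power_open]) auto
  also have "\<dots> = offspring_pgf b s ^ card S"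
    by (simp add: card_children offspring_pgf_def mult.commute flip: power_mult)
  finally show ?thesis .
qed

text \<open>
  Given the survivors \<open>S\<close> at level \<open>n\<close>, the next level is obtained by keeping each child of \<open>S\<close>
  independently with probability \<open>1 / b\<close>. The event that \<open>S\<close> is the set of survivors depends on
  words of length at most \<open>n\<close>, the fate of the children on words of length \<open>n + 1\<close>.
\<close>

lemma expectation_power_survivors_Suc:
  fixes s :: real
  shows "expectation (\<lambda>\<omega>. s ^ card (survivors (Suc n) \<omega>))
     = expectation (\<lambda>\<omega>. offspring_pgf b s ^ card (survivors n \<omega>))"
proof -
  define h where "h = (\<lambda>S \<omega>. \<Prod>w\<in>children b S. if X w \<omega> = real b then s else 1)"
  have power: "s ^ card (survivors (Suc n) \<omega>)
      = (\<Sum>S\<in>Pow (words b n). of_bool (survivors n \<omega> = S) * h S \<omega>)" for \<omega>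
  proof -
    have "finite (children b (survivors n \<omega>))"
      by (simp add: children_def)
    hence "s ^ card (survivors (Suc n) \<omega>) = h (survivors n \<omega>) \<omega>"
      by (simp add: alive_Suc h_def prod.If_cases Int_def)
    also have "\<dots> = (\<Sum>S\<in>Pow (words b n). of_bool (survivors n \<omega> = S) * h S \<omega>)"
      by (rule survivors_function[of "\<lambda>S. h S \<omega>"])
    finally show ?thesis .
  qed
  have factor: "expectation (\<lambda>\<omega>. of_bool (survivors n \<omega> = S) * h S \<omega>)
        = expectation (\<lambda>\<omega>. of_bool (survivors n \<omega> = S)) * offspring_pgf b s ^ card S"
    and int: "integrable M (\<lambda>\<omega>. of_bool (survivors n \<omega> = S) * h S \<omega>)"
    if S: "S \<in> Pow (words b n)" for S
  proof -
    let ?A = "shallow_words n" and ?C = "words b (Suc n)"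
    let ?P = "\<lambda>A. PiM A (\<lambda>_. borel :: real measure)"
    have sub: "children b S \<subseteq> ?C" using S by (intro children_subset) auto
    have "indep_var (?P ?A) (\<lambda>\<omega>. restrict (\<lambda>i. X i \<omega>) ?A) (?P ?C) (\<lambda>\<omega>. restrict (\<lambda>i. X i \<omega>) ?C)"
      by (rule indep_var_restrict[OF indep]) (auto simp: nonempty_words_def words_def)
    hence "indep_var borel ((\<lambda>x. of_bool (alive b n x = S)) \<circ> (\<lambda>\<omega>. restrict (\<lambda>i. X i \<omega>) ?A))
       borel ((\<lambda>x. \<Prod>w\<in>children b S. if x w = real b then s else 1) \<circ> (\<lambda>\<omega>. restrict (\<lambda>i. X i \<omega>) ?C))"
    proof (rule indep_var_compose)
      show "(\<lambda>x. of_bool (alive b n x = S) :: real) \<in> borel_measurable (?P ?A)"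
        using alive_measurable[of n S] by measurable
      have "(\<lambda>x. if x w = real b then s else 1) \<in> borel_measurable (?P ?C)" if "w \<in> children b S" for w
      proof -
        have [measurable]: "(\<lambda>x. x w) \<in> borel_measurable (?P ?C)"
          using that sub by (intro measurable_component_singleton) auto
        show ?thesis by measurable
      qed
      thus "(\<lambda>x. \<Prod>w\<in>children b S. if x w = real b then s else 1) \<in> borel_measurable (?P ?C)"
        by (intro borel_measurable_prod)
    qed
    moreover have "(\<lambda>x. \<Prod>w\<in>children b S. if x w = real b then s else 1) \<circ> (\<lambda>\<omega>. restrict (\<lambda>i. X i \<omega>) ?C)
        = h S"
      using sub by (auto simp: h_def fun_eq_iff intro!: prod.cong)
    ultimately have ind: "indep_var borel (\<lambda>\<omega>. of_bool (survivors n \<omega> = S)) borel (h S)"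
      by (simp add: comp_def alive_restrict)
    have inth: "integrable M (h S)"
    proof (rule integrable_const_bound[where B = "max \<bar>s\<bar> 1 ^ card (children b S)"])
      show "h S \<in> borel_measurable M"
        using ind by (auto simp: indep_var_eq)
      have "\<bar>h S \<omega>\<bar> \<le> (\<Prod>w\<in>children b S. max \<bar>s\<bar> 1)" for \<omega>
        unfolding h_def abs_prod by (intro prod_mono) auto
      thus "AE \<omega> in M. norm (h S \<omega>) \<le> max \<bar>s\<bar> 1 ^ card (children b S)" by simp
    qed
    note * = ind survivors_integrable[of "\<lambda>T. of_bool (T = S)" n] inth
    show "expectation (\<lambda>\<omega>. of_bool (survivors n \<omega> = S) * h S \<omega>)
        = expectation (\<lambda>\<omega>. of_bool (survivors n \<omega> = S)) * offspring_pgf b s ^ card S"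
      using indep_var_lebesgue_integral[OF *] expectation_power_children[of S n s] S
      by (simp add: h_def)
    show "integrable M (\<lambda>\<omega>. of_bool (survivors n \<omega> = S) * h S \<omega>)"
      by (rule indep_var_integrable[OF *])
  qed
  have "expectation (\<lambda>\<omega>. s ^ card (survivors (Suc n) \<omega>))
      = (\<Sum>S\<in>Pow (words b n). expectation (\<lambda>\<omega>. of_bool (survivors n \<omega> = S)) * offspring_pgf b s ^ card S)"
    by (simp only: power Bochner_Integration.integral_sum[OF int] factor cong: sum.cong)
  also have "\<dots> = expectation (\<lambda>\<omega>. offspring_pgf b s ^ card (survivors n \<omega>))"
    by (rule expectation_survivors[of "\<lambda>S. offspring_pgf b s ^ card S", symmetric])
  finally show ?thesis .
qed

lemma expectation_power_survivors:
  fixes s :: real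
  shows "expectation (\<lambda>\<omega>. s ^ card (survivors n \<omega>)) = (offspring_pgf b ^^ n) s"
proof (induction n arbitrary: s)
  case 0
  have "survivors 0 \<omega> = {[]}" for \<omega> by (auto simp: alive_def words_def)
  thus ?case by (simp add: prob_space)
next
  case (Suc n)
  thus ?case by (simp add: expectation_power_survivors_Suc funpow_swap1)
qed

lemma prob_word_alive:
  assumes j: "j \<in> words b n"
  shows "prob {\<omega> \<in> space M. j \<in> survivors n \<omega>} = (1 / real b) ^ n"
proof (cases "n = 0")
  case True
  thus ?thesis using j by (simp add: alive_def prob_space)
next
  case False
  define J where "J = (\<lambda>k. take k j) ` {1..n}"
  have len: "length j = n" using j by (simp add: words_def)
  have "inj_on (\<lambda>k. take k j) {1..n}"
    by (rule inj_onI) (metis atLeastAtMost_iff len length_take min.absorb2)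
  hence card: "card J = n" by (simp add: J_def card_image)
  have sub: "J \<subseteq> nonempty_words b"
    using take_in_words[OF j] by (fastforce simp: J_def nonempty_words_def)
  have "{\<omega> \<in> space M. j \<in> survivors n \<omega>} = (\<Inter>i\<in>J. X i -` {real b} \<inter> space M)"
    using j False by (auto simp: alive_def J_def)
  also have "prob \<dots> = (\<Prod>i\<in>J. prob (X i -` {real b} \<inter> space M))"
    using False sub by (intro indep_varsD[OF indep]) (auto simp: J_def)
  also have "\<dots> = (\<Prod>i\<in>J. 1 / real b)"
  proof (rule prod.cong)
    fix i assume "i \<in> J"
    hence "prob {\<omega> \<in> space M. X i \<omega> = real b} = 1 / real b" using sub by (intro prob_open) auto
    thus "prob (X i -` {real b} \<inter> space M) = 1 / real b"
      by (simp add: vimage_def Int_def conj_commute)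
  qed simp
  also have "\<dots> = (1 / real b) ^ n" by (simp add: card)
  finally show ?thesis .
qed

lemma expectation_card_survivors: "expectation (\<lambda>\<omega>. real (card (survivors n \<omega>))) = 1"
proof -
  have eq: "real (card (survivors n \<omega>)) = (\<Sum>j\<in>words b n. of_bool (j \<in> survivors n \<omega>))" for \<omega>
    using alive_subset by (simp add: of_bool_def sum.If_cases Int_absorb1)
  have "expectation (\<lambda>\<omega>. real (card (survivors n \<omega>)))
      = (\<Sum>j\<in>words b n. expectation (\<lambda>\<omega>. of_bool (j \<in> survivors n \<omega>)))"
    unfolding eq
    using survivors_integrable[of "\<lambda>S. of_bool (_ \<in> S)" n]
    by (intro Bochner_Integration.integral_sum)
  also have "\<dots> = (\<Sum>j\<in>words b n. (1 / real b) ^ n)"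
  proof (rule sum.cong)
    fix j assume j: "j \<in> words b n"
    have [measurable]: "{\<omega> \<in> space M. j \<in> survivors n \<omega>} \<in> events"
      using measurable_sets[OF survivors_measurable[of "\<lambda>S. of_bool (j \<in> S)" n], of "{1}"]
      by (simp add: vimage_def Int_def conj_commute)
    have "expectation (\<lambda>\<omega>. of_bool (j \<in> survivors n \<omega>) :: real)
        = expectation (indicator {\<omega> \<in> space M. j \<in> survivors n \<omega>})"
      by (intro Bochner_Integration.integral_cong) auto
    thus "expectation (\<lambda>\<omega>. of_bool (j \<in> survivors n \<omega>)) = (1 / real b) ^ n"
      using prob_word_alive[OF j] by simp
  qed simp
  also have "\<dots> = 1" using b by (simp add: card_words power_divide)
  finally show ?thesis .
qed

text \<open>
  Extinction has probability \<open>E[0 ^ Z\<^sub>n]\<close>, because \<open>0 ^ 0 = 1\<close>.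
\<close>

lemma expectation_nonextinction_le:
  "expectation (\<lambda>\<omega>. of_bool (card (survivors n \<omega>) \<noteq> 0)) \<le> (real b)\<^sup>2 / (real n + (real b)\<^sup>2)"
proof -
  have "expectation (\<lambda>\<omega>. of_bool (card (survivors n \<omega>) \<noteq> 0) :: real)
      = expectation (\<lambda>\<omega>. 1 - 0 ^ card (survivors n \<omega>))"
    by (intro Bochner_Integration.integral_cong refl) (simp add: power_0_left)
  also have "\<dots> = 1 - (offspring_pgf b ^^ n) 0"
    using survivors_integrable[of "\<lambda>S. 0 ^ card S" n]
    by (subst Bochner_Integration.integral_diff) (auto simp: expectation_power_survivors prob_space)
  also have "\<dots> \<le> (real b)\<^sup>2 / (real n + (real b)\<^sup>2)"
    using offspring_pgf_iterate_ge[OF b, of n] by simp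
  finally show ?thesis .
qed

text \<open>
  The tangent point \<open>l = n / b\<^sup>2\<close> is a lower bound for the reciprocal of the survival probability
  \<open>p\<close>, which is the mean of \<open>Z\<^sub>n\<close> given survival. Then \<open>l p \<le> 1\<close>, and the expectation
  \<open>q - (q - 1) l p\<close> of the tangent, up to the factor \<open>l powr (q - 1)\<close>, is at least one.
\<close>

lemma moment_ge:
  assumes "q > 1" "n \<ge> 1"
  shows "(real n / (real b)\<^sup>2) powr (q - 1) \<le> expectation (\<lambda>\<omega>. real (card (survivors n \<omega>)) powr q)"
proof -
  define l where "l = real n / (real b)\<^sup>2"
  define p :: real where "p = expectation (\<lambda>\<omega>. of_bool (card (survivors n \<omega>) \<noteq> 0))"
  have l: "l > 0" using assms b by (simp add: l_def)
  have "l * p \<le> l * ((real b)\<^sup>2 / (real n + (real b)\<^sup>2))"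
    using expectation_nonextinction_le[of n] l by (intro mult_left_mono) (auto simp: p_def)
  also have "\<dots> = real n / (real n + (real b)\<^sup>2)"
    using b by (simp add: l_def)
  also have "\<dots> \<le> 1"
    using assms by (subst divide_le_eq_1_pos) (auto intro: add_pos_nonneg)
  finally have lp: "l * p \<le> 1" .
  have "1 \<le> q - (q - 1) * (l * p)"
  proof -
    have "(q - 1) * (l * p) \<le> (q - 1) * 1"
      using lp assms by (intro mult_left_mono) auto
    thus ?thesis by simp
  qed
  hence "l powr (q - 1) * 1 \<le> l powr (q - 1) * (q - (q - 1) * (l * p))"
    by (intro mult_left_mono) auto
  also have "\<dots> = expectation (\<lambda>\<omega>. l powr (q - 1) * (q * real (card (survivors n \<omega>))
        - (q - 1) * l * of_bool (card (survivors n \<omega>) \<noteq> 0)))"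
    using survivors_integrable[of "\<lambda>S. q * real (card S)" n]
      survivors_integrable[of "\<lambda>S. (q - 1) * l * of_bool (card S \<noteq> 0)" n]
    by (simp add: Bochner_Integration.integral_diff expectation_card_survivors p_def del: of_bool_eq_1_iff)
  also have "\<dots> \<le> expectation (\<lambda>\<omega>. real (card (survivors n \<omega>)) powr q)"
  proof (rule integral_mono)
    show "integrable M (\<lambda>\<omega>. l powr (q - 1) * (q * real (card (survivors n \<omega>))
        - (q - 1) * l * of_bool (card (survivors n \<omega>) \<noteq> 0)))"
      by (rule survivors_integrable[of "\<lambda>S. l powr (q - 1) * (q * real (card S)
        - (q - 1) * l * of_bool (card S \<noteq> 0))"])
    show "integrable M (\<lambda>\<omega>. real (card (survivors n \<omega>)) powr q)"
      by (rule survivors_integrable[of "\<lambda>S. real (card S) powr q"])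
    fix \<omega>
    show "l powr (q - 1) * (q * real (card (survivors n \<omega>))
        - (q - 1) * l * of_bool (card (survivors n \<omega>) \<noteq> 0)) \<le> real (card (survivors n \<omega>)) powr q"
      using powr_ge_tangent[OF of_nat_0_le_iff assms(1) l, of "card (survivors n \<omega>)"]
      by (simp only: of_nat_eq_0_iff)
  qed
  finally show ?thesis by (simp add: l_def)
qed

text \<open>
  The exponent \<open>t\<close> must be of order \<open>1 / n\<close>, the reciprocal of the typical size of \<open>Z\<^sub>n\<close> given
  survival; the factor \<open>4\<close> keeps \<open>n (exp t - 1)\<close> below \<open>1 / 2\<close>, away from the pole of the comparison map.
\<close>

lemma moment_le:
  assumes "q > 1" "n \<ge> 1"
  shows "expectation (\<lambda>\<omega>. real (card (survivors n \<omega>)) powr q)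
           \<le> fact (nat \<lceil>q\<rceil>) * 4 powr q * real n powr (q - 1)"
proof -
  define t where "t = 1 / (4 * real n)"
  define h where "h = exp t - 1"
  define C :: real where "C = fact (nat \<lceil>q\<rceil>)"
  have t: "0 < t" "t \<le> 1 / 4" "real n * t = 1 / 4" using assms by (auto simp: t_def)
  have h: "0 \<le> h" "h \<le> 2 * t"
  proof -
    show "0 \<le> h" using t by (simp add: h_def)
    have "t\<^sup>2 \<le> t * 1" unfolding power2_eq_square using t by (intro mult_left_mono) auto
    thus "h \<le> 2 * t" using exp_bound[of t] t by (simp add: h_def)
  qed
  have nh: "real n * h \<le> 1 / 2"
    using mult_left_mono[OF h(2), of "real n"] t by simp
  have "expectation (\<lambda>\<omega>. exp t ^ card (survivors n \<omega>)) = (offspring_pgf b ^^ n) (1 + h)"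
    by (simp add: expectation_power_survivors h_def)
  also have "\<dots> \<le> 1 + h / (1 - real n * h)"
    using h nh b by (intro offspring_pgf_iterate_le) auto
  also have "h / (1 - real n * h) \<le> (2 * t) / (1 / 2)"
    using h nh by (intro frac_le) auto
  also have "(2 * t) / (1 / 2) = 1 / real n" by (simp add: t_def)
  finally have E: "expectation (\<lambda>\<omega>. exp t ^ card (survivors n \<omega>)) \<le> 1 + 1 / real n" by simp
  have pointwise: "real z powr q \<le> C / t powr q * (exp t ^ z - 1)" for z
  proof -
    have "real z powr q * t powr q = (real z * t) powr q"
      using t by (simp add: powr_mult)
    also have "\<dots> \<le> C * (exp (real z * t) - 1)"
      unfolding C_def using t assms by (intro powr_le_exp_minus_one) auto
    also have "exp (real z * t) = exp t ^ z"
      by (rule exp_of_nat_mult)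
    finally show ?thesis using t by (simp add: field_simps)
  qed
  have "expectation (\<lambda>\<omega>. real (card (survivors n \<omega>)) powr q)
      \<le> expectation (\<lambda>\<omega>. C / t powr q * (exp t ^ card (survivors n \<omega>) - 1))"
  proof (rule integral_mono)
    show "integrable M (\<lambda>\<omega>. C / t powr q * (exp t ^ card (survivors n \<omega>) - 1))"
      by (rule survivors_integrable[of "\<lambda>S. C / t powr q * (exp t ^ card S - 1)"])
    show "integrable M (\<lambda>\<omega>. real (card (survivors n \<omega>)) powr q)"
      by (rule survivors_integrable[of "\<lambda>S. real (card S) powr q"])
  qed (rule pointwise)
  also have "\<dots> = C / t powr q * (expectation (\<lambda>\<omega>. exp t ^ card (survivors n \<omega>)) - 1)"
    using survivors_integrable[of "\<lambda>S. exp t ^ card S" n]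
    by (simp add: Bochner_Integration.integral_diff prob_space)
  also have "\<dots> \<le> C / t powr q * (1 / real n)"
    using E t by (intro mult_left_mono) (auto simp: C_def)
  also have "\<dots> = C * 4 powr q * real n powr (q - 1)"
  proof -
    have "t powr q = 1 / (4 powr q * real n powr q)"
      using assms by (simp add: t_def powr_divide powr_mult)
    thus ?thesis using assms by (simp add: powr_diff)
  qed
  finally show ?thesis by (simp add: C_def)
qed

lemma ln_moment_over_ln_tendsto:
  assumes q: "q > 1"
  shows "(\<lambda>n. ln (expectation (\<lambda>\<omega>. real (card (survivors n \<omega>)) powr q)) / ln (real n))
           \<longlonglongrightarrow> q - 1"
proof (rule tendsto_sandwich)
  define m where "m = (\<lambda>n. expectation (\<lambda>\<omega>. real (card (survivors n \<omega>)) powr q))"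
  define C :: real where "C = fact (nat \<lceil>q\<rceil>) * 4 powr q"
  have C: "C > 0" by (simp add: C_def)
  have lower: "(q - 1) * (ln (real n) - ln ((real b)\<^sup>2)) \<le> ln (m n)"
    and upper: "ln (m n) \<le> ln C + (q - 1) * ln (real n)" if n: "n \<ge> 2" for n
  proof -
    have pos: "(real n / (real b)\<^sup>2) powr (q - 1) > 0" using n b by simp
    have ge: "(real n / (real b)\<^sup>2) powr (q - 1) \<le> m n"
      using moment_ge[OF q, of n] n by (simp add: m_def)
    have le: "m n \<le> C * real n powr (q - 1)"
      using moment_le[OF q, of n] n by (simp add: m_def C_def)
    have "ln ((real n / (real b)\<^sup>2) powr (q - 1)) \<le> ln (m n)"
      using ge pos by (subst ln_le_cancel_iff) linarith+
    thus "(q - 1) * (ln (real n) - ln ((real b)\<^sup>2)) \<le> ln (m n)"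
      using n b by (subst (asm) ln_powr, subst (asm) ln_div) auto
    have "ln (m n) \<le> ln (C * real n powr (q - 1))"
      using le ge pos by (subst ln_le_cancel_iff) linarith+
    thus "ln (m n) \<le> ln C + (q - 1) * ln (real n)"
      using n C by (simp add: ln_powr ln_mult)
  qed
  show "\<forall>\<^sub>F n in sequentially. (q - 1) * (ln (real n) - ln ((real b)\<^sup>2)) / ln (real n)
      \<le> ln (expectation (\<lambda>\<omega>. real (card (survivors n \<omega>)) powr q)) / ln (real n)"
    using eventually_ge_at_top[of 2]
    by eventually_elim (use lower in \<open>auto simp: m_def intro!: divide_right_mono\<close>)
  show "\<forall>\<^sub>F n in sequentially. ln (expectation (\<lambda>\<omega>. real (card (survivors n \<omega>)) powr q)) / ln (real n)
      \<le> (ln (fact (nat \<lceil>q\<rceil>) * 4 powr q) + (q - 1) * ln (real n)) / ln (real n)"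
    using eventually_ge_at_top[of 2]
    by eventually_elim (use upper in \<open>auto simp: m_def C_def intro!: divide_right_mono\<close>)
  have ln_lim: "(\<lambda>n. c / ln (real n)) \<longlonglongrightarrow> 0" for c
    by (intro tendsto_divide_0[OF tendsto_const] filterlim_at_top_imp_at_infinity
          filterlim_compose[OF ln_at_top filterlim_real_sequentially])
  have ev: "\<forall>\<^sub>F n in sequentially. ln (real n) \<noteq> 0"
    using eventually_ge_at_top[of 2] by eventually_elim auto
  have lim: "(\<lambda>n. (c + (q - 1) * ln (real n)) / ln (real n)) \<longlonglongrightarrow> q - 1" for c
  proof (rule Lim_transform_eventually)
    show "(\<lambda>n. c / ln (real n) + (q - 1)) \<longlonglongrightarrow> q - 1"
      using tendsto_add[OF ln_lim tendsto_const, of c "q - 1"] by simp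
    show "\<forall>\<^sub>F n in sequentially. c / ln (real n) + (q - 1) = (c + (q - 1) * ln (real n)) / ln (real n)"
      using ev by eventually_elim (simp add: add_divide_distrib)
  qed
  show "(\<lambda>n. (q - 1) * (ln (real n) - ln ((real b)\<^sup>2)) / ln (real n)) \<longlonglongrightarrow> q - 1"
    using lim[of "- (q - 1) * ln ((real b)\<^sup>2)"] by (simp add: algebra_simps)
  show "(\<lambda>n. (ln (fact (nat \<lceil>q\<rceil>) * 4 powr q) + (q - 1) * ln (real n)) / ln (real n)) \<longlonglongrightarrow> q - 1"
    by (rule lim)
qed

end

section \<open>The cascade\<close>

theorem theorem1p1:
  fixes b :: nat and q :: real
    and N :: "'w measure" and W :: "'w \<Rightarrow> real"
    and M :: "'a measure" and X :: "nat list \<Rightarrow> 'a \<Rightarrow> real"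
  assumes "b \<ge> 2"
    and "prob_space N" and "has_TC_law b N W"
    and "prob_space M" and "independent_copies N W M (nonempty_words b) X"
    and "q > 1"
  shows "(\<lambda>n. ln (prob_space.expectation M (\<lambda>\<omega>. cascade b X n \<omega> powr q)) / ln (real n))
           \<longlonglongrightarrow> q - 1"
proof -
  interpret prob_space M by fact
  have indep: "indep_vars (\<lambda>_. borel) X (nonempty_words b)"
    and law: "\<And>i. i \<in> nonempty_words b \<Longrightarrow> distr M borel (X i) = distr N borel W"
    using assms by (auto simp: independent_copies_def)
  have rv: "X i \<in> borel_measurable M" if "i \<in> nonempty_words b" for i
    using indep that by (auto simp: indep_vars_def)
  have W: "W \<in> borel_measurable N" using assms by (simp add: has_TC_law_def)
  have transfer: "prob {\<omega> \<in> space M. X i \<omega> = c} = measure N {\<omega> \<in> space N. W \<omega> = c}"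
    if i: "i \<in> nonempty_words b" for i c
  proof -
    have "prob {\<omega> \<in> space M. X i \<omega> = c} = measure (distr M borel (X i)) {c}"
      using rv[OF i] by (simp add: measure_distr vimage_def Int_def conj_commute)
    also have "\<dots> = measure N {\<omega> \<in> space N. W \<omega> = c}"
      using W by (simp add: law[OF i] measure_distr vimage_def Int_def conj_commute)
    finally show ?thesis .
  qed
  interpret percolated_tree M b X
    using assms indep transfer by unfold_locales (auto simp: has_TC_law_def)
  \<comment> \<open>The two prescribed masses add up to one; all words together are countable, so a single null
    set serves for every \<open>i\<close>.\<close>
  have "AE \<omega> in M. X i \<omega> \<in> {0, real b}" if i: "i \<in> nonempty_words b" for i
  proof -
    have [measurable]: "X i \<in> borel_measurable M" using i by (rule rv)
    have "prob ({\<omega> \<in> space M. X i \<omega> = 0} \<union> {\<omega> \<in> space M. X i \<omega> = real b})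
        = prob {\<omega> \<in> space M. X i \<omega> = 0} + prob {\<omega> \<in> space M. X i \<omega> = real b}"
      using b by (intro finite_measure_Union) auto
    also have "\<dots> = 1"
      using assms by (simp add: transfer[OF i] has_TC_law_def)
    also have "{\<omega> \<in> space M. X i \<omega> = 0} \<union> {\<omega> \<in> space M. X i \<omega> = real b}
        = {\<omega> \<in> space M. X i \<omega> \<in> {0, real b}}" by auto
    finally show ?thesis by (subst (asm) prob_eq_1) auto
  qed
  moreover have "countable (nonempty_words b)" by (rule countableI_type)
  ultimately have "AE \<omega> in M. \<forall>i\<in>nonempty_words b. X i \<omega> \<in> {0, real b}"
    by (simp add: AE_ball_countable)
  hence AE: "AE \<omega> in M. cascade b X n \<omega> = real (card (survivors n \<omega>))" for n
    by eventually_elim (use b in \<open>auto intro!: cascade_eq_card_alive\<close>)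
  have "expectation (\<lambda>\<omega>. cascade b X n \<omega> powr q)
      = expectation (\<lambda>\<omega>. real (card (survivors n \<omega>)) powr q)" for n
  proof (rule integral_cong_AE)
    have "(\<lambda>\<omega>. X (take k j) \<omega>) \<in> borel_measurable M" if "j \<in> words b n" "k \<in> {1..n}" for j k
      using take_in_words[OF that(1), of k] that(2) by (intro rv) (auto simp: nonempty_words_def)
    thus "(\<lambda>\<omega>. cascade b X n \<omega> powr q) \<in> borel_measurable M"
      unfolding cascade_def
      by (intro powr_real_measurable borel_measurable_times borel_measurable_sum
            borel_measurable_prod borel_measurable_const)
    show "(\<lambda>\<omega>. real (card (survivors n \<omega>)) powr q) \<in> borel_measurable M"
      by (rule survivors_measurable[of "\<lambda>S. real (card S) powr q"])
    show "AE \<omega> in M. cascade b X n \<omega> powr q = real (card (survivors n \<omega>)) powr q"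
      using AE[of n] by eventually_elim simp
  qed
  thus ?thesis using ln_moment_over_ln_tendsto[OF \<open>q > 1\<close>] by simp
qed

end
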